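(* Let $\alpha>-1$. (i) If $\alpha>0$, then for every $n\ge0$, $\|\ell_n^{(\alpha)}\|_\infty\le\|\ell_{n+1}^{(\alpha-1)}\|_1$. (ii) $\ell_n^{(\alpha)}\in L^1(\mathbb R_+)$ for all $n\ge0$, and there is a constant $C_\alpha>0$ such that for all $n\ge1$, $$\max_{t\in\mathcal Z(L_n^{(\alpha)})}|\ell_{n-1}^{(\alpha)}(t)|\le\|\ell_n^{(\alpha)}\|_1\le\frac{C_\alpha}{n^{\alpha/2}},$$ where $\mathcal Z(L_n^{(\alpha)})$ is the set of zeros of $L_n^{(\alpha)}$. (iii) Let $p\ge1$ and $\alpha>-\frac1p$. Then $\ell_n^{(\alpha)}\in L^p(\mathbb R_+)$ for all $n\ge0$, and there is $C_{p,\alpha}>0$ with $\|\ell_n^{(\alpha)}\|_p\le C_{p,\alpha}\,n^{1/2}$ for all $n\ge1$.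
   Context: $L_n^{(\alpha)}(t)=\sum_{k=0}^n(-1)^k\binom{n+\alpha}{n-k}\frac{t^k}{k!}$ is the generalized Laguerre polynomial, and $\ell_n^{(\alpha)}(t):=\frac{n!}{\Gamma(n+\alpha+1)}t^{\alpha}e^{-t}L_n^{(\alpha)}(t)$ for $t>0$. $\|\cdot\|_p$ denotes the norm of $L^p(\mathbb R_+)$, $\mathbb R_+=[0,\infty)$, and $\|\cdot\|_\infty$ the essential supremum norm. *)

theory Defs
  imports "HOL-Probability.Probability"
begin

definition laguerre :: "nat \<Rightarrow> real \<Rightarrow> real \<Rightarrow> real" where
  "laguerre n \<alpha> t = (\<Sum>k\<le>n. (-1)^k * ((real n + \<alpha>) gchoose (n - k)) * t ^ k / fact k)"

text \<open>Normalized Laguerre function ell_n^(alpha)(t) for t > 0 (set to 0 for t <= 0,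
  which is irrelevant for norms on R_+ since {0} is a null set).\<close>
definition ell :: "nat \<Rightarrow> real \<Rightarrow> real \<Rightarrow> real" where
  "ell n \<alpha> t = (if t > 0 then fact n / Gamma (real n + \<alpha> + 1) * t powr \<alpha> * exp (- t) * laguerre n \<alpha> t
                  else 0)"

definition in_Lp :: "real \<Rightarrow> (real \<Rightarrow> real) \<Rightarrow> bool" where
  "in_Lp p f \<longleftrightarrow> f \<in> borel_measurable (restrict_space lborel {0..})
      \<and> set_integrable lborel {0..} (\<lambda>t. \<bar>f t\<bar> powr p)"

definition Lp_norm :: "real \<Rightarrow> (real \<Rightarrow> real) \<Rightarrow> real" where
  "Lp_norm p f = (LINT t:{0..}|lborel. \<bar>f t\<bar> powr p) powr (1 / p)"

definition Linf_norm :: "(real \<Rightarrow> real) \<Rightarrow> ereal" where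
  "Linf_norm f = esssup (restrict_space lborel {0..}) (\<lambda>t. ereal \<bar>f t\<bar>)"

end

theory Submission
  imports Defs "HOL-Real_Asymp.Real_Asymp"
begin

text \<open>
  Write \<open>ell n \<alpha> t = t^\<alpha> e^(-t) M n \<alpha> t\<close> with \<open>M\<close> a polynomial. Then \<open>(ell n \<alpha>)' = ell (n+1) (\<alpha>-1)\<close> and
  \<open>ell n \<alpha> - ell (n+1) \<alpha> = ell n (\<alpha>+1)\<close>. The first identity integrates to (i); with the second, (i) for
  \<open>\<alpha>+1\<close> gives the lower bound in (ii) at the zeros. Integration by parts yields the exact value
  \<open>n! / \<Gamma>(n+\<alpha>+1)\<close>, of order \<open>n^(-\<alpha>)\<close>, for the integral of \<open>t^\<alpha> e^(-t) M^2\<close>, and Cauchy-Schwarz (as AM-GM with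
  an optimal weight) gives the upper bound in (ii). For (iii), \<open>M\<close> is bounded on \<open>[0,1/n]\<close> uniformly in \<open>n\<close>.
  If \<open>\<alpha> \<ge> -1/2\<close>, then \<open>|M| \<le> C n^(1/2) e^(t/2)\<close> for all \<open>t\<close>, and \<open>t^(\<alpha>p) e^(-pt/2)\<close> is integrable. If
  \<open>\<alpha> < -1/2\<close>, then \<open>p < 2\<close> and the part beyond \<open>1/n\<close> is handled by the square integral.
\<close>

section \<open>Recurrences and derivatives of the polynomials \<open>lagm\<close>\<close>

text \<open>For \<open>\<alpha> > -1\<close> this is \<open>n! / \<Gamma>(n+\<alpha>+1) L_n^(\<alpha>)\<close>. The entire function \<open>rGamma = 1/\<Gamma>\<close> makes
  the recurrences below hold for every real \<open>\<alpha>\<close>.\<close>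
definition lagm :: "nat \<Rightarrow> real \<Rightarrow> real \<Rightarrow> real" where
  "lagm n \<alpha> t = (\<Sum>k\<le>n. (-1)^k * real (n choose k) * rGamma (\<alpha> + real k + 1) * t ^ k)"

lemma not_nonpos_Ints_if_pos: "x > 0 \<Longrightarrow> (x::real) \<notin> \<int>\<^sub>\<le>\<^sub>0"
  by (auto elim!: nonpos_Ints_cases)

text \<open>The binomial coefficient of n + \<alpha> over n - k is Gamma (n + \<alpha> + 1) / ((n -
  k)! Gamma (\<alpha> + k + 1)), and 1 / (k! (n - k)!) is n choose k divided by n!. The hypothesis
  keeps n + \<alpha> + 1 off the poles of Gamma.\<close>

lemma laguerre_conv_lagm:
  assumes "\<alpha> > -1"
  shows "laguerre n \<alpha> t = Gamma (real n + \<alpha> + 1) / fact n * lagm n \<alpha> t"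
proof -
  have "(-1)^k * ((real n + \<alpha>) gchoose (n - k)) * t ^ k / fact k =
        Gamma (real n + \<alpha> + 1) / fact n *
        ((-1)^k * real (n choose k) * rGamma (\<alpha> + real k + 1) * t ^ k)" if "k \<le> n" for k
  proof -
    have "real n + \<alpha> + 1 \<notin> \<int>\<^sub>\<le>\<^sub>0"
      using assms by (intro not_nonpos_Ints_if_pos) auto
    from gbinomial_Gamma[OF this, of "n - k"] that
    have "(real n + \<alpha>) gchoose (n - k) = Gamma (real n + \<alpha> + 1) * rGamma (\<alpha> + real k + 1) / fact (n - k)"
      by (simp add: of_nat_diff algebra_simps rGamma_inverse_Gamma divide_simps)
    moreover have "real (n choose k) = fact n / (fact k * fact (n - k))"
      using that by (simp add: binomial_fact)
    ultimately show ?thesis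
      by (simp add: mult_ac)
  qed
  then show ?thesis
    unfolding laguerre_def lagm_def sum_distrib_left by (intro sum.cong) auto
qed

text \<open>The point t = 0 is included because \<open>0 powr \<alpha> = 0\<close> agrees with the
  value 0 in \<open>ell\<close>, so integrands over \<open>{0..}\<close> match everywhere.\<close>

lemma ell_conv_lagm:
  assumes "\<alpha> > -1" "t \<ge> 0"
  shows "ell n \<alpha> t = t powr \<alpha> * exp (-t) * lagm n \<alpha> t"
proof -
  have "Gamma (real n + \<alpha> + 1) \<noteq> 0"
    using assms by (intro less_imp_neq[symmetric] Gamma_real_pos) auto
  then show ?thesis
    using assms by (auto simp: ell_def laguerre_conv_lagm)
qed

text \<open>Pascal's rule splits the sum; in the second half, shifting k by one raises \<alpha> by
  one and produces the factor - t.\<close>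

lemma lagm_Suc: "lagm (Suc n) \<alpha> t = lagm n \<alpha> t - t * lagm n (\<alpha> + 1) t"
proof -
  define g where "g k = (-1::real)^k * rGamma (\<alpha> + real k + 1) * t ^ k" for k
  have "lagm (Suc n) \<alpha> t = g 0 + (\<Sum>k\<le>n. real (Suc n choose Suc k) * g (Suc k))"
    unfolding lagm_def g_def by (subst sum.atMost_Suc_shift) (simp add: mult_ac)
  also have "\<dots> = g 0 + (\<Sum>k\<le>n. real (n choose Suc k) * g (Suc k)) + (\<Sum>k\<le>n. real (n choose k) * g (Suc k))"
    by (simp add: sum.distrib algebra_simps)
  also have "g 0 + (\<Sum>k\<le>n. real (n choose Suc k) * g (Suc k)) = (\<Sum>k\<le>Suc n. real (n choose k) * g k)"
    by (subst sum.atMost_Suc_shift) simp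
  also have "\<dots> = lagm n \<alpha> t"
    unfolding lagm_def g_def by (simp add: mult_ac)
  also have "(\<Sum>k\<le>n. real (n choose k) * g (Suc k)) = - t * lagm n (\<alpha> + 1) t"
    unfolding lagm_def g_def sum_distrib_left by (intro sum.cong) (auto simp: algebra_simps)
  finally show ?thesis by simp
qed

text \<open>Termwise differentiation with the absorption rule (k + 1) (m + 1 choose k + 1) = (m + 1)
  (m choose k). For n = 0 the truncated n - 1 is harmless, as the factor n vanishes.\<close>

lemma has_field_derivative_lagm:
  "((lagm n \<alpha>) has_field_derivative (- real n * lagm (n - 1) (\<alpha> + 1) t)) (at t)"
proof -
  define c where "c k = (-1::real)^k * real (n choose k) * rGamma (\<alpha> + real k + 1)" for k
  have "((\<lambda>t. \<Sum>k\<le>n. c k * t ^ k) has_field_derivative (\<Sum>k\<le>n. c k * (real k * t ^ (k - 1)))) (at t)"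
    by (auto intro!: derivative_eq_intros sum.cong)
  also have "(\<Sum>k\<le>n. c k * (real k * t ^ (k - 1))) = - real n * lagm (n - 1) (\<alpha> + 1) t"
  proof (cases n)
    case (Suc m)
    have "real (Suc k) * real (Suc m choose Suc k) = real (Suc m) * real (m choose k)" for k
      using Suc_times_binomial_eq[of m k] by (metis of_nat_mult mult.commute)
    moreover have "c (Suc k) * real (Suc k) =
        - ((-1)^k * (real (Suc k) * real (Suc m choose Suc k)) * rGamma (\<alpha> + 1 + real k + 1))" for k
      unfolding c_def Suc by (simp add: add_ac del: binomial_Suc_Suc)
    ultimately have "c (Suc k) * real (Suc k) =
        - (real n * ((-1)^k * real (m choose k) * rGamma (\<alpha> + 1 + real k + 1)))" for k
      unfolding Suc by (simp add: mult_ac)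
    then have "(\<Sum>k\<le>m. c (Suc k) * real (Suc k) * t ^ k) =
          (\<Sum>k\<le>m. - (real n * ((-1)^k * real (m choose k) * rGamma (\<alpha> + 1 + real k + 1))) * t ^ k)"
      by (intro sum.cong) auto
    also have "\<dots> = - real n * lagm m (\<alpha> + 1) t"
      unfolding lagm_def sum_distrib_left by (intro sum.cong) auto
    finally show ?thesis
      unfolding Suc by (subst sum.atMost_Suc_shift) (simp add: mult_ac)
  qed simp
  finally show ?thesis
    unfolding c_def lagm_def .
qed

lemmas has_field_derivative_lagm' [derivative_intros] =
  DERIV_chain2[OF has_field_derivative_lagm]

text \<open>The operator \<alpha> + t d/dt multiplies the coefficient of t^k by \<alpha> + k, and
  the functional equation of \<open>rGamma\<close> absorbs this factor by lowering \<alpha> by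
  one.\<close>

lemma lagm_lower_parameter:
  "lagm n (\<alpha> - 1) t = \<alpha> * lagm n \<alpha> t - t * real n * lagm (n - 1) (\<alpha> + 1) t"
proof -
  define c where "c k = (-1::real)^k * real (n choose k) * rGamma (\<alpha> + real k + 1)" for k
  have "((\<lambda>t. \<Sum>k\<le>n. c k * t ^ k) has_field_derivative (\<Sum>k\<le>n. c k * (real k * t ^ (k - 1)))) (at t)"
    by (auto intro!: derivative_eq_intros sum.cong)
  \<comment> \<open>Uniqueness of the derivative puts the termwise sum into closed form.\<close>
  then have *: "(\<Sum>k\<le>n. c k * (real k * t ^ (k - 1))) = - real n * lagm (n - 1) (\<alpha> + 1) t"
    using has_field_derivative_lagm[of n \<alpha> t] DERIV_unique unfolding lagm_def c_def by blast
  have "\<alpha> * lagm n \<alpha> t - t * real n * lagm (n - 1) (\<alpha> + 1) t =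
      (\<Sum>k\<le>n. \<alpha> * (c k * t ^ k)) + t * (\<Sum>k\<le>n. c k * (real k * t ^ (k - 1)))"
    unfolding lagm_def[of n \<alpha>] c_def[symmetric] * by (simp flip: sum_distrib_left)
  also have "\<dots> = (\<Sum>k\<le>n. (\<alpha> + real k) * (c k * t ^ k))"
    unfolding sum_distrib_left sum.distrib[symmetric]
  proof (intro sum.cong refl)
    fix k
    show "\<alpha> * (c k * t ^ k) + t * (c k * (real k * t ^ (k - 1))) = (\<alpha> + real k) * (c k * t ^ k)"
      by (cases k) (auto simp: algebra_simps)
  qed
  also have "\<dots> = lagm n (\<alpha> - 1) t"
    unfolding lagm_def
  proof (intro sum.cong refl)
    fix k
    have "(\<alpha> + real k) * rGamma (\<alpha> + real k + 1) = rGamma (\<alpha> + real k)"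
      by (rule rGamma_plus1)
    then have "(\<alpha> + real k) * c k = (-1)^k * real (n choose k) * rGamma (\<alpha> - 1 + real k + 1)"
      unfolding c_def by (simp add: mult.left_commute)
    then show "(\<alpha> + real k) * (c k * t ^ k) = (-1)^k * real (n choose k) * rGamma (\<alpha> - 1 + real k + 1) * t ^ k"
      by (simp only: mult.assoc[symmetric])
  qed
  finally show ?thesis ..
qed

text \<open>The product rule gives t^(\<alpha> - 1) e^(-t) (\<alpha> M + t M' - t M).
  \<open>lagm_lower_parameter\<close> rewrites \<alpha> M + t M' as
  \<open>lagm n (\<alpha> - 1) t\<close>, and \<open>lagm_Suc\<close> at \<alpha> - 1 absorbs - t
  M.\<close>

lemma has_field_derivative_weighted_lagm:
  assumes "t > 0"
  shows "((\<lambda>t. t powr \<alpha> * exp (-t) * lagm n \<alpha> t) has_field_derivative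
          (t powr (\<alpha> - 1) * exp (-t) * lagm (Suc n) (\<alpha> - 1) t)) (at t)"
proof -
  have "t powr \<alpha> = t * t powr (\<alpha> - 1)"
    using assms by (simp add: powr_diff)
  then show ?thesis
    using assms
    by (auto intro!: derivative_eq_intros simp: lagm_Suc lagm_lower_parameter[of n \<alpha>] algebra_simps)
qed

section \<open>Continuity, measurability, growth and integrability\<close>

lemma continuous_on_lagm [continuous_intros]:
  "continuous_on A f \<Longrightarrow> continuous_on A (\<lambda>x. lagm n \<alpha> (f x))"
  unfolding lagm_def by (intro continuous_intros)

lemma isCont_lagm [continuous_intros]:
  "isCont f x \<Longrightarrow> isCont (\<lambda>x. lagm n \<alpha> (f x)) x"
  unfolding lagm_def by (intro continuous_intros)

lemma borel_measurable_lagm [measurable]: "lagm n \<alpha> \<in> borel_measurable borel"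
  by (intro borel_measurable_continuous_onI continuous_intros)

lemma borel_measurable_ell [measurable]: "ell n \<alpha> \<in> borel_measurable borel"
  unfolding ell_def laguerre_def by measurable

lemma power_le_exp:
  assumes "a > 0" "t \<ge> (0::real)"
  shows "t ^ k \<le> fact k / a ^ k * exp (a * t)"
proof -
  have "(\<Sum>i<Suc k. (a * t) ^ i /\<^sub>R fact i) \<le> exp (a * t)"
    unfolding exp_def using assms
    by (intro sum_le_suminf summable_exp_generic) auto
  moreover have "(a * t) ^ k /\<^sub>R fact k \<le> (\<Sum>i<Suc k. (a * t) ^ i /\<^sub>R fact i)"
    using assms by (intro member_le_sum) auto
  ultimately show ?thesis
    using assms by (simp add: field_simps)
qed

text \<open>Each power is at most a multiple of e^(a t). \<open>K\<close> depends on n, so this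
  serves only integrability and limits at infinity; bounds uniform in n come later.\<close>

lemma lagm_exp_bound:
  assumes "a > 0"
  obtains K where "K \<ge> 0" "\<And>t. t \<ge> 0 \<Longrightarrow> \<bar>lagm n \<alpha> t\<bar> \<le> K * exp (a * t)"
proof -
  define c where "c k = \<bar>(-1::real)^k * real (n choose k) * rGamma (\<alpha> + real k + 1)\<bar>" for k
  have "\<bar>lagm n \<alpha> t\<bar> \<le> (\<Sum>k\<le>n. c k * (fact k / a ^ k)) * exp (a * t)" if "t \<ge> 0" for t
  proof -
    have "\<bar>lagm n \<alpha> t\<bar> \<le> (\<Sum>k\<le>n. c k * t ^ k)"
      unfolding lagm_def c_def using that
      by (intro order.trans[OF sum_abs] sum_mono) (auto simp: abs_mult)
    also have "\<dots> \<le> (\<Sum>k\<le>n. c k * (fact k / a ^ k * exp (a * t)))"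
      using that assms by (intro sum_mono mult_left_mono power_le_exp) (auto simp: c_def)
    finally show ?thesis
      by (simp add: sum_distrib_right mult.assoc)
  qed
  moreover have "(\<Sum>k\<le>n. c k * (fact k / a ^ k)) \<ge> 0"
    using assms by (intro sum_nonneg) (auto simp: c_def)
  ultimately show ?thesis
    using that by blast
qed

text \<open>The norm of the complex Gamma integrand is the real one. Passing from
  \<open>{0<..}\<close> to \<open>{0..}\<close> changes nothing since
  \<open>0 powr \<beta> = 0\<close>, and Borel measurability allows the passage from Lebesgue
  measure to \<open>lborel\<close>.\<close>

lemma set_integrable_powr_exp:
  fixes \<beta> :: real
  assumes "\<beta> > -1" "a > 0"
  shows "set_integrable lborel {0..} (\<lambda>t. t powr \<beta> * exp (- (a * t)))"
proof -
  have "(\<lambda>t. complex_of_real t powr (complex_of_real (\<beta> + 1) - 1) / of_real (exp (a * t)))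
             absolutely_integrable_on {0<..}"
    using assms by (intro absolutely_integrable_Gamma_integral) auto
  then have "(\<lambda>t. norm (complex_of_real t powr (complex_of_real (\<beta> + 1) - 1) / of_real (exp (a * t))))
             absolutely_integrable_on {0<..}"
    by (rule absolutely_integrable_norm[unfolded o_def])
  also have "?this \<longleftrightarrow> (\<lambda>t. t powr \<beta> * exp (- (a * t))) absolutely_integrable_on {0<..}"
    by (intro set_integrable_cong) (auto simp: norm_divide norm_powr_real_powr exp_minus field_simps)
  finally have "integrable lebesgue (\<lambda>t. indicator {0<..} t *\<^sub>R (t powr \<beta> * exp (- (a * t))))"
    unfolding set_integrable_def .
  also have "(\<lambda>t. indicator {0<..} t *\<^sub>R (t powr \<beta> * exp (- (a * t)))) =
             (\<lambda>t. indicator {0..} t *\<^sub>R (t powr \<beta> * exp (- (a * t))))"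
    by (auto simp: indicator_def fun_eq_iff)
  finally show ?thesis
    unfolding set_integrable_def by (subst (asm) integrable_completion) auto
qed

lemma set_integral_powr_exp:
  fixes \<beta> :: real
  assumes "\<beta> > -1"
  shows "(LINT t:{0..}|lborel. t powr \<beta> * exp (-t)) = Gamma (\<beta> + 1)"
proof -
  have "(LINT t:{0..}|lborel. t powr \<beta> * exp (-t)) = integral {0..} (\<lambda>t. t powr \<beta> * exp (-t))"
    using set_integrable_powr_exp[of \<beta> 1] assms by (intro set_borel_integral_eq_integral) simp
  also have "\<dots> = Gamma (\<beta> + 1)"
    using Gamma_integral_real[of "\<beta> + 1"] assms
    by (intro integral_unique) (simp add: exp_minus divide_inverse)
  finally show ?thesis .
qed

lemma set_integrable_powr_exp_bound:
  assumes "\<beta> > -1" "a > 0" "f \<in> borel_measurable borel"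
    and "\<And>t. t \<ge> 0 \<Longrightarrow> \<bar>f t\<bar> \<le> K * (t powr \<beta> * exp (- (a * t)))"
  shows "set_integrable lborel {0..} (f :: real \<Rightarrow> real)"
proof (rule set_integrable_bound)
  show "set_integrable lborel {0..} (\<lambda>t. K * (t powr \<beta> * exp (- (a * t))))"
    using set_integrable_powr_exp[OF assms(1,2)] by (rule set_integrable_mult_right)
  show "set_borel_measurable lborel {0..} f"
    using assms(3) unfolding set_borel_measurable_def by measurable
  show "AE t in lborel. t \<in> {0..} \<longrightarrow> norm (f t) \<le> norm (K * (t powr \<beta> * exp (- (a * t))))"
    using assms(4) by (auto intro: order.trans[OF _ abs_ge_self])
qed

text \<open>Each polynomial is granted e^(t/4), which leaves half of the decay of e^(-t). The
  majorant is integrable for \<beta> > -1 and tends to 0 at infinity, so it also controls boundary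
  terms.\<close>

lemma powr_exp_lagm_lagm_bound:
  obtains K where
    "\<And>t. t \<ge> 0 \<Longrightarrow> \<bar>t powr \<beta> * exp (-t) * (lagm n \<alpha> t * lagm m \<gamma> t)\<bar> \<le> K * (t powr \<beta> * exp (- (1/2 * t)))"
proof -
  obtain K1 where K1: "K1 \<ge> 0" "\<And>t. t \<ge> 0 \<Longrightarrow> \<bar>lagm n \<alpha> t\<bar> \<le> K1 * exp (1/4 * t)"
    using lagm_exp_bound[of "1/4"] by auto
  obtain K2 where K2: "K2 \<ge> 0" "\<And>t. t \<ge> 0 \<Longrightarrow> \<bar>lagm m \<gamma> t\<bar> \<le> K2 * exp (1/4 * t)"
    using lagm_exp_bound[of "1/4"] by auto
  have "\<bar>t powr \<beta> * exp (-t) * (lagm n \<alpha> t * lagm m \<gamma> t)\<bar> \<le> (K1 * K2) * (t powr \<beta> * exp (- (1/2 * t)))"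
    if "t \<ge> 0" for t
  proof -
    have "\<bar>lagm n \<alpha> t * lagm m \<gamma> t\<bar> \<le> (K1 * exp (1/4 * t)) * (K2 * exp (1/4 * t))"
      unfolding abs_mult using K1 K2 that by (intro mult_mono) auto
    also have "\<dots> = K1 * K2 * exp (1/2 * t)"
      by (simp flip: exp_add)
    finally have "t powr \<beta> * exp (-t) * \<bar>lagm n \<alpha> t * lagm m \<gamma> t\<bar> \<le> t powr \<beta> * exp (-t) * (K1 * K2 * exp (1/2 * t))"
      by (intro mult_left_mono) auto
    also have "\<dots> = (K1 * K2) * (t powr \<beta> * (exp (-t) * exp (1/2 * t)))"
      by simp
    finally show ?thesis
      by (simp add: abs_mult flip: exp_add)
  qed
  then show ?thesis
    using that by blast
qed

lemma set_integrable_lagm_lagm: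
  assumes "\<beta> > -1"
  shows "set_integrable lborel {0..} (\<lambda>t. t powr \<beta> * exp (-t) * (lagm n \<alpha> t * lagm m \<gamma> t))"
proof -
  obtain K where "\<And>t. t \<ge> 0 \<Longrightarrow>
      \<bar>t powr \<beta> * exp (-t) * (lagm n \<alpha> t * lagm m \<gamma> t)\<bar> \<le> K * (t powr \<beta> * exp (- (1/2 * t)))"
    using powr_exp_lagm_lagm_bound by blast
  then show ?thesis
    using assms by (intro set_integrable_powr_exp_bound[of \<beta> "1/2" _ K]) auto
qed

section \<open>The exact square integral\<close>

text \<open>The fundamental theorem of calculus with vanishing boundary values, in the form used for
  integration by parts. \<open>zero\<close> makes the integrands over the open and the closed half
  line agree pointwise.\<close>

lemma set_integral_half_line_eq_0:
  fixes F f :: "real \<Rightarrow> real"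
  assumes deriv: "\<And>t. t > 0 \<Longrightarrow> (F has_field_derivative f t) (at t)"
    and cont: "\<And>t. t > 0 \<Longrightarrow> isCont f t"
    and int: "set_integrable lborel {0..} f"
    and zero: "f 0 = 0"
    and lims: "(F \<longlongrightarrow> 0) (at_right 0)" "(F \<longlongrightarrow> 0) at_top"
  shows "(LINT t:{0..}|lborel. f t) = 0"
proof -
  have "(LBINT t=ereal 0..\<infinity>. f t) = 0 - 0"
  proof (rule interval_integral_FTC_integrable)
    show "set_integrable lborel (einterval (ereal 0) \<infinity>) f"
      by (rule set_integrable_subset[OF int]) (auto simp: einterval_def)
    show "((F \<circ> real_of_ereal) \<longlongrightarrow> 0) (at_right (ereal 0))"
      using lims by (simp add: ereal_tendsto_simps)
    show "((F \<circ> real_of_ereal) \<longlongrightarrow> 0) (at_left \<infinity>)"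
      using lims by (simp add: ereal_tendsto_simps)
  qed (use deriv cont in \<open>auto simp: has_real_derivative_iff_has_vector_derivative\<close>)
  moreover have "(LBINT t=ereal 0..\<infinity>. f t) = (LINT t:{0..}|lborel. f t)"
    unfolding interval_integral_to_infinity_eq set_lebesgue_integral_def
    using zero by (intro Bochner_Integration.integral_cong) (auto simp: indicator_def less_le)
  ultimately show ?thesis by simp
qed

lemma tendsto_powr_mult_at_right_0:
  fixes f :: "real \<Rightarrow> real"
  assumes "a > 0" "isCont f 0"
  shows "((\<lambda>t. t powr a * f t) \<longlongrightarrow> 0) (at_right 0)"
proof -
  have "((\<lambda>t::real. t powr a) \<longlongrightarrow> 0) (at_right 0)"
    using assms(1) by real_asymp
  moreover have "(f \<longlongrightarrow> f 0) (at_right 0)"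
    using assms(2) by (simp add: isCont_def filterlim_at_split)
  ultimately show ?thesis
    using tendsto_mult by fastforce
qed

text \<open>Integration by parts gives I(n + 1, \<alpha>) = (n + 1) I(n, \<alpha> + 1) for the
  integral I, which is why \<alpha> varies in the induction. The Gamma argument is the same on both
  sides, and I(0, \<alpha>) is a Gamma integral divided by Gamma (\<alpha> + 1)^2.\<close>

lemma set_integral_lagm_squared:
  assumes "\<alpha> > -1"
  shows "(LINT t:{0..}|lborel. t powr \<alpha> * exp (-t) * (lagm n \<alpha> t)\<^sup>2) = fact n / Gamma (real n + \<alpha> + 1)"
  using assms
proof (induction n arbitrary: \<alpha>)
  case 0
  have "Gamma (\<alpha> + 1) > 0"
    using 0 by (intro Gamma_real_pos) auto
  moreover have "(LINT t:{0..}|lborel. t powr \<alpha> * exp (-t) * (lagm 0 \<alpha> t)\<^sup>2) =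
      (LINT t:{0..}|lborel. t powr \<alpha> * exp (-t)) * (rGamma (\<alpha> + 1))\<^sup>2"
    by (simp add: lagm_def)
  ultimately show ?case
    using set_integral_powr_exp[OF 0]
    by (simp add: rGamma_inverse_Gamma power2_eq_square field_simps)
next
  case (Suc n)
  \<comment> \<open>The derivative of t^(\<alpha> + 1) e^(-t) \<open>lagm n (\<alpha> + 1) t\<close>
    is t^\<alpha> e^(-t) \<open>lagm (Suc n) \<alpha> t\<close>, so F' = f1 - (n + 1) f2.\<close>
  define F where "F t = t powr (\<alpha> + 1) * exp (-t) * (lagm n (\<alpha> + 1) t * lagm (Suc n) \<alpha> t)" for t
  define f1 where "f1 t = t powr \<alpha> * exp (-t) * (lagm (Suc n) \<alpha> t * lagm (Suc n) \<alpha> t)" for t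
  define f2 where "f2 t = t powr (\<alpha> + 1) * exp (-t) * (lagm n (\<alpha> + 1) t * lagm n (\<alpha> + 1) t)" for t
  have int: "set_integrable lborel {0..} f1" "set_integrable lborel {0..} f2"
    unfolding f1_def f2_def using Suc.prems by (auto intro!: set_integrable_lagm_lagm)
  have "(LINT t:{0..}|lborel. f1 t - real (Suc n) * f2 t) = 0"
  proof (rule set_integral_half_line_eq_0)
    fix t :: real
    assume t: "t > 0"
    have "(F has_field_derivative
        (t powr (\<alpha> + 1 - 1) * exp (-t) * lagm (Suc n) (\<alpha> + 1 - 1) t) * lagm (Suc n) \<alpha> t +
        (t powr (\<alpha> + 1) * exp (-t) * lagm n (\<alpha> + 1) t) * (- real (Suc n) * lagm (Suc n - 1) (\<alpha> + 1) t)) (at t)"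
      unfolding F_def mult.assoc[symmetric]
      by (rule derivative_eq_intros has_field_derivative_weighted_lagm[OF t] has_field_derivative_lagm refl)+
        simp
    then show "(F has_field_derivative f1 t - real (Suc n) * f2 t) (at t)"
      by (rule DERIV_cong) (simp add: f1_def f2_def algebra_simps)
    show "isCont (\<lambda>t. f1 t - real (Suc n) * f2 t) t"
      unfolding f1_def f2_def using t by (intro continuous_intros) auto
  next
    show "set_integrable lborel {0..} (\<lambda>t. f1 t - real (Suc n) * f2 t)"
      using int by auto
    show "f1 0 - real (Suc n) * f2 0 = 0"
      by (simp add: f1_def f2_def)
    show "(F \<longlongrightarrow> 0) (at_right 0)"
      unfolding F_def mult.assoc using Suc.prems
      by (intro tendsto_powr_mult_at_right_0 continuous_intros) auto
    obtain K where "\<And>t. t \<ge> 0 \<Longrightarrow> \<bar>F t\<bar> \<le> K * (t powr (\<alpha> + 1) * exp (- (1/2 * t)))"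
      unfolding F_def using powr_exp_lagm_lagm_bound by blast
    then have "eventually (\<lambda>t. norm (F t) \<le> K * (t powr (\<alpha> + 1) * exp (- (1/2 * t)))) at_top"
      by (auto intro: eventually_mono[OF eventually_ge_at_top[of 0]])
    moreover have "((\<lambda>t. K * (t powr (\<alpha> + 1) * exp (- (1/2 * t)))) \<longlongrightarrow> 0) at_top"
      by real_asymp
    ultimately show "(F \<longlongrightarrow> 0) at_top"
      by (rule Lim_null_comparison)
  qed
  then have "(LINT t:{0..}|lborel. f1 t) = real (Suc n) * (LINT t:{0..}|lborel. f2 t)"
    using int by simp
  also have "(LINT t:{0..}|lborel. f2 t) = fact n / Gamma (real n + (\<alpha> + 1) + 1)"
    using Suc.IH[of "\<alpha> + 1"] Suc.prems by (simp add: f2_def power2_eq_square)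
  finally show ?case
    by (simp add: f1_def power2_eq_square algebra_simps)
qed

section \<open>The sup norm bound and the lower bound at zeros\<close>

text \<open>As \<alpha> > 0, \<open>ell n \<alpha>\<close> is the antiderivative of
  \<open>ell (Suc n) (\<alpha> - 1)\<close> that tends to 0 at 0, so its value at x > 0 is an
  integral over (0, x).\<close>

lemma abs_ell_le_L1:
  assumes "\<alpha> > 0"
  shows "\<bar>ell n \<alpha> x\<bar> \<le> (LINT t:{0..}|lborel. \<bar>ell (Suc n) (\<alpha> - 1) t\<bar>)"
proof (cases "x > 0")
  case False
  then show ?thesis
    by (auto simp: ell_def set_lebesgue_integral_def intro!: Bochner_Integration.integral_nonneg)
next
  case True
  define F where "F t = t powr \<alpha> * exp (-t) * lagm n \<alpha> t" for t
  define f where "f t = t powr (\<alpha> - 1) * exp (-t) * lagm (Suc n) (\<alpha> - 1) t" for t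
  \<comment> \<open>The constant 1 serves as the second factor in
    \<open>set_integrable_lagm_lagm\<close>.\<close>
  have "lagm 0 0 t = 1" for t
    by (simp add: lagm_def)
  then have int: "set_integrable lborel {0..} f"
    using set_integrable_lagm_lagm[of "\<alpha> - 1" "Suc n" "\<alpha> - 1" 0 0] assms by (simp add: f_def[abs_def])
  have int': "set_integrable lborel {0<..<x} f"
    by (rule set_integrable_subset[OF int]) auto
  have "(LBINT t=ereal 0..ereal x. f t) = F x - 0"
  proof (rule interval_integral_FTC_integrable)
    show "set_integrable lborel (einterval (ereal 0) (ereal x)) f"
      using int' by simp
    have "(F \<longlongrightarrow> 0) (at_right 0)"
      unfolding F_def mult.assoc using assms
      by (intro tendsto_powr_mult_at_right_0 continuous_intros) auto
    then show "((F \<circ> real_of_ereal) \<longlongrightarrow> 0) (at_right (ereal 0))"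
      by (simp add: ereal_tendsto_simps)
    have "isCont F x"
      unfolding F_def using True by (intro continuous_intros) auto
    then have "(F \<longlongrightarrow> F x) (at_left x)"
      by (auto simp: isCont_def intro: filterlim_at_split[THEN iffD1, THEN conjunct1])
    then show "((F \<circ> real_of_ereal) \<longlongrightarrow> F x) (at_left (ereal x))"
      by (simp add: ereal_tendsto_simps)
    show "(F has_vector_derivative f t) (at t)" if "ereal 0 < ereal t" for t
      using has_field_derivative_weighted_lagm[of t \<alpha> n] that
      unfolding F_def f_def by (simp add: has_real_derivative_iff_has_vector_derivative)
    show "isCont f t" if "ereal 0 < ereal t" for t
      unfolding f_def using that by (intro continuous_intros) auto
  qed (use True in auto)
  then have "F x = (LINT t:{0<..<x}|lborel. f t)"
    using True by (simp add: interval_lebesgue_integral_def)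
  also have "\<bar>\<dots>\<bar> \<le> (LINT t:{0<..<x}|lborel. \<bar>f t\<bar>)"
    using set_integral_norm_bound[OF int'] by simp
  also have "\<dots> \<le> (LINT t:{0..}|lborel. \<bar>f t\<bar>)"
    unfolding set_lebesgue_integral_def
    using set_integrable_abs[OF int] set_integrable_abs[OF int']
    by (intro integral_mono) (auto simp: set_integrable_def indicator_def)
  also have "\<dots> = (LINT t:{0..}|lborel. \<bar>ell (Suc n) (\<alpha> - 1) t\<bar>)"
    using assms by (intro set_lebesgue_integral_cong) (auto simp: ell_conv_lagm f_def)
  finally show ?thesis
    using assms True by (simp add: ell_conv_lagm F_def)
qed

lemma ell_diff:
  assumes "\<alpha> > -1"
  shows "ell n \<alpha> t - ell (Suc n) \<alpha> t = ell n (\<alpha> + 1) t"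
proof (cases "t > 0")
  case True
  then show ?thesis
    using assms by (simp add: ell_conv_lagm lagm_Suc powr_add algebra_simps)
qed (simp add: ell_def)

text \<open>At a zero, \<open>ell_diff\<close> reduces to
  \<open>ell n \<alpha> t = ell n (\<alpha> + 1) t\<close>, and \<alpha> + 1 > 0 admits
  \<open>abs_ell_le_L1\<close>, which lowers the parameter back to \<alpha>. Points t \<le> 0 are
  covered since \<open>ell\<close> is 0 there.\<close>

lemma abs_ell_le_L1_at_zero:
  assumes "\<alpha> > -1" "laguerre (Suc n) \<alpha> t = 0"
  shows "\<bar>ell n \<alpha> t\<bar> \<le> (LINT t:{0..}|lborel. \<bar>ell (Suc n) \<alpha> t\<bar>)"
proof -
  have "ell (Suc n) \<alpha> t = 0"
    using assms by (simp add: ell_def)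
  then have "ell n \<alpha> t = ell n (\<alpha> + 1) t"
    using ell_diff[OF assms(1), of n t] by simp
  then show ?thesis
    using abs_ell_le_L1[of "\<alpha> + 1" n t] assms by simp
qed

section \<open>Membership in L^p and the upper bound for the L^1 norm\<close>

text \<open>The sequence \<open>Gamma_series'\<close> at \<alpha> + 1 converges to Gamma (\<alpha> +
  1) and is therefore bounded; for n \<ge> 1 its n-th term is n^\<alpha> n! Gamma (\<alpha> + 1) /
  Gamma (n + \<alpha> + 1).\<close>

lemma Gamma_quotient_bound:
  assumes "\<alpha> > -1"
  obtains K where "K > 0" "\<And>n. n \<ge> 1 \<Longrightarrow> fact n / Gamma (real n + \<alpha> + 1) \<le> K * real n powr (-\<alpha>)"
proof -
  have pos: "Gamma (real n + \<alpha> + 1) > 0" "Gamma (\<alpha> + 1) > 0" for n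
    using assms by (auto intro!: Gamma_real_pos)
  have "Bseq (Gamma_series' (\<alpha> + 1))"
    using Gamma_series'_LIMSEQ convergent_def by (intro convergent_imp_Bseq) blast
  then obtain K where K: "K > 0" "\<And>n. norm (Gamma_series' (\<alpha> + 1) n) \<le> K"
    unfolding Bseq_def by blast
  have "fact n / Gamma (real n + \<alpha> + 1) \<le> (K / Gamma (\<alpha> + 1)) * real n powr (-\<alpha>)" if "n \<ge> 1" for n
  proof -
    have "fact (n - 1) = fact n / real n"
      using that by (subst fact_reduce[of n]) auto
    moreover have "pochhammer (\<alpha> + 1) n = Gamma (real n + \<alpha> + 1) / Gamma (\<alpha> + 1)"
      using assms by (subst pochhammer_Gamma) (auto intro!: not_nonpos_Ints_if_pos simp: add_ac)
    moreover have "exp ((\<alpha> + 1) * ln (real n)) = real n * real n powr \<alpha>"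
      using that by (simp add: powr_def ring_distribs exp_add)
    ultimately have "Gamma_series' (\<alpha> + 1) n =
        (fact n / Gamma (real n + \<alpha> + 1)) * real n powr \<alpha> * Gamma (\<alpha> + 1)"
      using that by (simp add: Gamma_series'_def)
    then have "(fact n / Gamma (real n + \<alpha> + 1)) * real n powr \<alpha> * Gamma (\<alpha> + 1) \<le> K"
      using abs_le_D1[OF K(2)[of n, unfolded real_norm_def]] by simp
    then show ?thesis
      using pos that by (simp add: powr_minus field_simps)
  qed
  then show ?thesis
    using that[of "K / Gamma (\<alpha> + 1)"] K pos by simp
qed

lemma set_integrable_lagm_squared:
  assumes "\<alpha> > -1"
  shows "set_integrable lborel {0..} (\<lambda>t. t powr \<alpha> * exp (-t) * (lagm n \<alpha> t)\<^sup>2)"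
  using set_integrable_lagm_lagm[OF assms, of n \<alpha> n \<alpha>] by (simp add: power2_eq_square)

text \<open>Half of e^(-t) pays for e^(t/2), and p \<ge> 1 weakens e^(-pt/2) to e^(-t/2).
  \<open>B\<close> stays explicit so that its growth in n can be tracked.\<close>

lemma abs_ell_powr_le:
  assumes "\<alpha> > -1" "p \<ge> 1" "t \<ge> 0" "B \<ge> 0" "\<bar>lagm n \<alpha> t\<bar> \<le> B * exp (1/2 * t)"
  shows "\<bar>ell n \<alpha> t\<bar> powr p \<le> B powr p * (t powr (\<alpha> * p) * exp (- (1/2 * t)))"
proof -
  have "\<bar>ell n \<alpha> t\<bar> = t powr \<alpha> * exp (-t) * \<bar>lagm n \<alpha> t\<bar>"
    using assms by (simp add: ell_conv_lagm abs_mult)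
  also have "\<dots> \<le> t powr \<alpha> * exp (-t) * (B * exp (1/2 * t))"
    using assms by (intro mult_left_mono) auto
  also have "\<dots> = B * (t powr \<alpha> * (exp (-t) * exp (1/2 * t)))"
    by simp
  also have "\<dots> = B * (t powr \<alpha> * exp (- (1/2 * t)))"
    by (simp flip: exp_add)
  finally have "\<bar>ell n \<alpha> t\<bar> powr p \<le> (B * (t powr \<alpha> * exp (- (1/2 * t)))) powr p"
    using assms by (intro powr_mono2) auto
  also have "\<dots> = B powr p * (t powr (\<alpha> * p) * exp (- (1/2 * t) * p))"
    using assms by (simp add: powr_mult powr_powr exp_powr_real)
  also have "\<dots> \<le> B powr p * (t powr (\<alpha> * p) * exp (- (1/2 * t)))"
    using assms mult_left_mono[of 1 p t] by (intro mult_left_mono) auto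
  finally show ?thesis .
qed

text \<open>The condition \<alpha> > -1/p means \<alpha> p > -1, which makes the majorant from
  \<open>abs_ell_powr_le\<close> integrable at 0.\<close>

lemma set_integrable_abs_ell_powr:
  assumes "p \<ge> 1" "\<alpha> > - 1 / p"
  shows "set_integrable lborel {0..} (\<lambda>t. \<bar>ell n \<alpha> t\<bar> powr p)"
proof -
  have "\<alpha> * p > -1" "\<alpha> > -1"
    using assms by (auto simp: field_simps) (smt (verit) mult_less_cancel_left1)
  obtain K where "K \<ge> 0" "\<And>t. t \<ge> 0 \<Longrightarrow> \<bar>lagm n \<alpha> t\<bar> \<le> K * exp (1/2 * t)"
    using lagm_exp_bound[of "1/2"] by auto
  then have "\<bar>\<bar>ell n \<alpha> t\<bar> powr p\<bar> \<le> K powr p * (t powr (\<alpha> * p) * exp (- (1/2 * t)))" if "t \<ge> 0" for t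
    using abs_ell_powr_le[of \<alpha> p t K n] assms \<open>\<alpha> > -1\<close> that by simp
  then show ?thesis
    using \<open>\<alpha> * p > -1\<close>
    by (intro set_integrable_powr_exp_bound[of "\<alpha> * p" "1/2" _ "K powr p"]) auto
qed

lemma in_Lp_ell:
  assumes "p \<ge> 1" "\<alpha> > - 1 / p"
  shows "in_Lp p (ell n \<alpha>)"
  unfolding in_Lp_def using set_integrable_abs_ell_powr[OF assms]
  by (auto intro!: measurable_restrict_space1)

lemma L1_ell_bound:
  assumes "\<alpha> > -1"
  obtains C where "C > 0"
    "\<And>n. n \<ge> 1 \<Longrightarrow> (LINT t:{0..}|lborel. \<bar>ell n \<alpha> t\<bar>) \<le> C / real n powr (\<alpha> / 2)"
proof -
  obtain K where K: "K > 0" "\<And>n. n \<ge> 1 \<Longrightarrow> fact n / Gamma (real n + \<alpha> + 1) \<le> K * real n powr (-\<alpha>)"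
    using Gamma_quotient_bound[OF assms] by blast
  have "(LINT t:{0..}|lborel. \<bar>ell n \<alpha> t\<bar>) \<le> (Gamma (\<alpha> + 1) + K) / 2 / real n powr (\<alpha> / 2)" if "n \<ge> 1" for n
  proof -
    \<comment> \<open>The AM-GM weight: up to the factor \<open>K\<close>, l^2 bounds the square
      integral, so both terms of |M| \<le> l/2 + M^2/(2l) have weighted integrals at most a multiple
      of l.\<close>
    define l where "l = real n powr (- \<alpha> / 2)"
    have l: "l > 0"
      using that by (simp add: l_def)
    have l_inv: "l = 1 / real n powr (\<alpha> / 2)"
      using powr_minus_divide[of "real n" "\<alpha> / 2"] by (simp add: l_def)
    have lsq: "real n powr (-\<alpha>) = l * l"
      unfolding l_def by (simp flip: powr_add)
    define f where "f t = l / 2 * (t powr \<alpha> * exp (-t)) + 1 / (2 * l) * (t powr \<alpha> * exp (-t) * (lagm n \<alpha> t)\<^sup>2)" for t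
    have int1: "set_integrable lborel {0..} (\<lambda>t. t powr \<alpha> * exp (-t))"
      using set_integrable_powr_exp[of \<alpha> 1] assms by simp
    have "(LINT t:{0..}|lborel. \<bar>ell n \<alpha> t\<bar>) \<le> (LINT t:{0..}|lborel. f t)"
    proof (rule set_integral_mono)
      show "set_integrable lborel {0..} (\<lambda>t. \<bar>ell n \<alpha> t\<bar>)"
        using set_integrable_abs_ell_powr[of 1 \<alpha> n] assms by simp
      show "set_integrable lborel {0..} f"
        unfolding f_def using assms
        by (intro set_integral_add set_integrable_mult_right int1 set_integrable_lagm_squared)
    next
      fix t :: real
      assume "t \<in> {0..}"
      then have "\<bar>ell n \<alpha> t\<bar> = t powr \<alpha> * exp (-t) * \<bar>lagm n \<alpha> t\<bar>"
        using assms by (simp add: ell_conv_lagm abs_mult)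
      moreover have "2 * l * \<bar>lagm n \<alpha> t\<bar> \<le> l\<^sup>2 + \<bar>lagm n \<alpha> t\<bar>\<^sup>2"
        by (rule sum_squares_bound)
      then have "\<bar>lagm n \<alpha> t\<bar> \<le> l / 2 + 1 / (2 * l) * (lagm n \<alpha> t)\<^sup>2"
        using l by (simp add: field_simps power2_eq_square)
      then have "t powr \<alpha> * exp (-t) * \<bar>lagm n \<alpha> t\<bar>
          \<le> t powr \<alpha> * exp (-t) * (l / 2 + 1 / (2 * l) * (lagm n \<alpha> t)\<^sup>2)"
        by (intro mult_left_mono) auto
      moreover have "\<dots> = f t"
        by (simp add: f_def algebra_simps)
      ultimately show "\<bar>ell n \<alpha> t\<bar> \<le> f t"
        by simp
    qed
    also have "(LINT t:{0..}|lborel. f t) = l / 2 * Gamma (\<alpha> + 1) + 1 / (2 * l) * (fact n / Gamma (real n + \<alpha> + 1))"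
      unfolding f_def set_integral_powr_exp[OF assms, symmetric] set_integral_lagm_squared[OF assms, symmetric]
      by (subst set_integral_add)
        (intro set_integrable_mult_right int1 set_integrable_lagm_squared[OF assms]
          | simp only: set_integral_mult_right)+
    also have "\<dots> \<le> l / 2 * Gamma (\<alpha> + 1) + 1 / (2 * l) * (K * (l * l))"
      using K(2)[OF that] l unfolding lsq by (intro add_left_mono mult_left_mono) auto
    also have "\<dots> = (Gamma (\<alpha> + 1) + K) / 2 * l"
      using l by (simp add: field_simps)
    also have "\<dots> = (Gamma (\<alpha> + 1) + K) / 2 / real n powr (\<alpha> / 2)"
      unfolding l_inv by simp
    finally show ?thesis .
  qed
  moreover have "Gamma (\<alpha> + 1) > 0"
    using assms by (intro Gamma_real_pos) auto
  ultimately show ?thesis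
    using that[of "(Gamma (\<alpha> + 1) + K) / 2"] K(1) by simp
qed

section \<open>Pointwise bounds with explicit dependence on n\<close>

text \<open>For n t \<le> 1 one has (n choose k) t^k \<le> (n t)^k / k! \<le> 1/k!, and the values
  of \<open>rGamma\<close> at \<alpha> + k + 1 are bounded by some \<open>B\<close>, so the sum is
  at most B e.\<close>

lemma lagm_bound_near_0:
  assumes "\<alpha> > -1"
  obtains S where "S > 0" "\<And>n t. t \<ge> 0 \<Longrightarrow> real n * t \<le> 1 \<Longrightarrow> \<bar>lagm n \<alpha> t\<bar> \<le> S"
proof -
  define B where "B = max (rGamma (\<alpha> + 1)) (rGamma (\<alpha> + 2))"
  have pos: "rGamma (\<alpha> + real k + 1) > 0" for k
    using assms Gamma_real_pos[of "\<alpha> + real k + 1"] by (simp add: rGamma_inverse_Gamma)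
  have rG: "rGamma (\<alpha> + real k + 1) \<le> B" for k
  proof (induction k)
    case (Suc k)
    show ?case
    proof (cases "k = 0")
      case False
      \<comment> \<open>From k = 1 on, the factor \<alpha> + k + 1 exceeds 1, so the values
        decrease; only the step from k = 0 can increase, whence the two entries in
        \<open>B\<close>.\<close>
      have "1 * rGamma (\<alpha> + real (Suc k) + 1) \<le> (\<alpha> + real k + 1) * rGamma (\<alpha> + real k + 1 + 1)"
        using assms False pos[of "Suc k"] by (intro mult_mono) (auto simp: add_ac)
      then show ?thesis
        using Suc.IH rGamma_plus1[of "\<alpha> + real k + 1"] by simp
    qed (simp add: B_def add_ac)
  qed (simp add: B_def)
  have "B > 0"
    using pos[of 0] rG[of 0] by simp
  have "\<bar>lagm n \<alpha> t\<bar> \<le> B * exp 1" if t: "t \<ge> 0" "real n * t \<le> 1" for n t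
  proof -
    have "\<bar>lagm n \<alpha> t\<bar> \<le> (\<Sum>k\<le>n. B * (1 / fact k))"
      unfolding lagm_def
    proof (intro order.trans[OF sum_abs] sum_mono)
      fix k
      have "real (n choose k) * fact k \<le> real n ^ k"
        using binomial_fact_pow[of n k] by (metis of_nat_fact of_nat_le_iff of_nat_mult of_nat_power)
      then have "real (n choose k) * t ^ k \<le> (real n ^ k / fact k) * t ^ k"
        using t by (intro mult_right_mono) (auto simp: field_simps)
      also have "\<dots> = (real n * t) ^ k / fact k"
        by (simp add: power_mult_distrib)
      also have "\<dots> \<le> 1 / fact k"
        using t by (intro divide_right_mono power_le_one) auto
      finally have "rGamma (\<alpha> + real k + 1) * (real (n choose k) * t ^ k) \<le> B * (1 / fact k)"
        using rG[of k] pos[of k] t \<open>B > 0\<close> by (intro mult_mono) auto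
      then show "\<bar>(- 1) ^ k * real (n choose k) * rGamma (\<alpha> + real k + 1) * t ^ k\<bar> \<le> B * (1 / fact k)"
        using pos[of k] t by (simp add: abs_mult mult_ac)
    qed
    also have "\<dots> = B * (\<Sum>k\<le>n. 1 / fact k)"
      by (simp add: sum_distrib_left)
    also have "(\<Sum>k\<le>n. 1 / fact k) \<le> exp (1::real)"
      unfolding exp_def using summable_exp_generic[of "1::real"]
      by (simp add: divide_inverse) (intro sum_le_suminf, auto)
    finally show ?thesis
      using \<open>B > 0\<close> by simp
  qed
  then show ?thesis
    using that[of "B * exp 1"] \<open>B > 0\<close> by simp
qed

text \<open>The Sonin-type quantity \<open>t^(\<alpha>+1/2) e^(-t) M(t)^2\<close> is controlled at \<open>1/n\<close> by the bound near 0; by AM-GM,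
  its derivative beyond \<open>1/n\<close> is dominated by the two square integrals known exactly, those of
  \<open>M\<close> and of \<open>M'\<close>.\<close>
lemma lagm_sqrt_bound:
  assumes "\<alpha> \<ge> -1/2"
  obtains C where "C \<ge> 0" "\<And>n t. n \<ge> 1 \<Longrightarrow> t \<ge> 0 \<Longrightarrow> \<bar>lagm n \<alpha> t\<bar> \<le> C * sqrt (real n) * exp (1/2 * t)"
proof -
  have "\<alpha> > -1"
    using assms by simp
  obtain K where K: "K > 0" "\<And>n. n \<ge> 1 \<Longrightarrow> fact n / Gamma (real n + \<alpha> + 1) \<le> K * real n powr (-\<alpha>)"
    using Gamma_quotient_bound[OF \<open>\<alpha> > -1\<close>] by blast
  obtain S where S: "S > 0" "\<And>n t. t \<ge> 0 \<Longrightarrow> real n * t \<le> 1 \<Longrightarrow> \<bar>lagm n \<alpha> t\<bar> \<le> S"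
    using lagm_bound_near_0[OF \<open>\<alpha> > -1\<close>] by blast
  \<comment> \<open>The two summands bound the integral of \<open>G\<close> and the value
    \<open>g a\<close>, each relative to n^(1/2 - \<alpha>).\<close>
  define C0 where "C0 = (\<alpha> + 5/2) * K + S\<^sup>2"
  have "C0 \<ge> 0"
    using assms K(1) by (auto simp: C0_def)
  have far: "\<bar>lagm n \<alpha> x\<bar> \<le> sqrt C0 * sqrt (real n) * exp (1/2 * x)"
    if n: "n \<ge> 1" and x: "real n * x \<ge> 1" for n x
  proof -
    define r where "r = sqrt (real n)"
    define a where "a = 1 / real n"
    have r: "r > 0" "real n = r * r" and a: "a > 0" "a \<le> x" "real n * a = 1"
      using n x by (auto simp: r_def a_def field_simps)
    define M where "M = lagm n \<alpha>"
    define N where "N = lagm (n - 1) (\<alpha> + 1)"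
    define g where "g t = t powr (\<alpha> + 1/2) * exp (-t) * (M t)\<^sup>2" for t
    define g' where "g' t = ((\<alpha> + 1/2) * t powr (\<alpha> - 1/2) - t powr (\<alpha> + 1/2)) * exp (-t) * (M t)\<^sup>2
        + t powr (\<alpha> + 1/2) * exp (-t) * (2 * M t * (- real n * N t))" for t
    \<comment> \<open>Here M' = - n N. With r = n^(1/2), the bound t^(-1/2) \<le> r handles the term
      with \<alpha> + 1/2, and AM-GM gives -2 n t^(1/2) M N \<le> r M^2 + n r t N^2.\<close>
    define G where "G t = ((\<alpha> + 3/2) * r) * (t powr \<alpha> * exp (-t) * (M t)\<^sup>2)
        + (real n * r) * (t powr (\<alpha> + 1) * exp (-t) * (N t)\<^sup>2)" for t
    have g'_le_G: "g' t \<le> G t" if t: "t \<ge> a" for t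
    proof -
      define s where "s = sqrt t"
      define u where "u = t powr \<alpha> * exp (-t)"
      have "t > 0"
        using a t by linarith
      then have s: "s > 0" "t = s * s" and "u \<ge> 0"
        by (auto simp: s_def u_def)
      have "real n * t \<ge> 1"
        using t n by (simp add: a_def field_simps)
      then have "r * s \<ge> 1"
        by (simp add: r_def s_def flip: real_sqrt_mult)
      have powrs: "t powr (\<alpha> - 1/2) = t powr \<alpha> / s" "t powr (\<alpha> + 1/2) = t powr \<alpha> * s"
        "t powr (\<alpha> + 1) = t powr \<alpha> * (s * s)"
        using \<open>t > 0\<close> by (simp_all add: powr_diff powr_add powr_half_sqrt s_def)
      \<comment> \<open>The cross term is absorbed by completing a square; \<alpha> + 1/2 \<ge> 0
        and 1/s \<le> r settle the rest.\<close>
      have "G t - g' t = u * (((\<alpha> + 1/2) * (r - 1 / s) + s) * (M t)\<^sup>2 + r * (M t + r * s * N t)\<^sup>2)"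
        unfolding G_def g'_def r(2) u_def powrs using s(1) by (simp add: field_simps power2_eq_square)
      moreover have "1 / s \<le> r"
        using \<open>r * s \<ge> 1\<close> s(1) by (simp add: field_simps)
      then have "u * (((\<alpha> + 1/2) * (r - 1 / s) + s) * (M t)\<^sup>2 + r * (M t + r * s * N t)\<^sup>2) \<ge> 0"
        using \<open>u \<ge> 0\<close> r(1) s(1) assms by (intro mult_nonneg_nonneg add_nonneg_nonneg[of "_ * _"]) auto
      ultimately show ?thesis
        by linarith
    qed
    have cont: "isCont g' t" if "t \<ge> a" for t
      unfolding g'_def M_def N_def using that a by (intro continuous_intros) auto
    have deriv: "DERIV g t :> g' t" if "t \<ge> a" for t
    proof -
      have "t > 0"
        using that a by linarith
      then show ?thesis
        unfolding g_def g'_def M_def N_def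
        by (auto intro!: derivative_eq_intros simp: algebra_simps power2_eq_square)
    qed
    have int: "set_integrable lborel {0..} (\<lambda>t. t powr \<alpha> * exp (-t) * (M t)\<^sup>2)"
      "set_integrable lborel {0..} (\<lambda>t. t powr (\<alpha> + 1) * exp (-t) * (N t)\<^sup>2)"
      unfolding M_def N_def using assms by (auto intro!: set_integrable_lagm_squared)
    then have intG: "set_integrable lborel {0..} G"
      unfolding G_def by (intro set_integral_add set_integrable_mult_right)
    have "G t \<ge> 0" for t
      unfolding G_def using assms r by (intro add_nonneg_nonneg[of "_ * _"] mult_nonneg_nonneg) auto
    have FTC: "has_bochner_integral lborel (\<lambda>t. g' t * indicator {a..x} t) (g x - g a)"
      using a deriv cont by (intro has_bochner_integral_FTC_Icc_real) auto
    then have "g x - g a = (\<integral>t. g' t * indicator {a..x} t \<partial>lborel)"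
      by (simp add: has_bochner_integral_iff)
    also have "\<dots> \<le> (LINT t:{0..}|lborel. G t)"
      unfolding set_lebesgue_integral_def
      using FTC intG g'_le_G \<open>\<And>t. G t \<ge> 0\<close> a
      by (intro integral_mono) (auto simp: has_bochner_integral_iff set_integrable_def indicator_def)
    \<comment> \<open>Both square integrals lead to the same Gamma quotient, because n (n - 1)! = n!
      and the Gamma arguments agree.\<close>
    also have "\<dots> = ((\<alpha> + 3/2) * r) * (fact n / Gamma (real n + \<alpha> + 1))
        + (real n * r) * (fact (n - 1) / Gamma (real (n - 1) + (\<alpha> + 1) + 1))"
      unfolding G_def using int assms set_integral_lagm_squared[of \<alpha> n]
        set_integral_lagm_squared[of "\<alpha> + 1" "n - 1"]
      by (subst set_integral_add) (auto simp: M_def N_def intro!: set_integrable_mult_right)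
    also have "real (n - 1) + (\<alpha> + 1) + 1 = real n + \<alpha> + 1"
      using n by simp
    also have "real n * r * (fact (n - 1) / Gamma (real n + \<alpha> + 1)) = r * (fact n / Gamma (real n + \<alpha> + 1))"
      using n by (simp add: fact_reduce[of n])
    also have "(\<alpha> + 3/2) * r * (fact n / Gamma (real n + \<alpha> + 1)) + r * (fact n / Gamma (real n + \<alpha> + 1))
        = (\<alpha> + 5/2) * r * (fact n / Gamma (real n + \<alpha> + 1))"
    proof -
      have "(\<alpha> + 3/2) * r * q + r * q = (\<alpha> + 5/2) * r * q" for q
        by (simp add: algebra_simps)
      then show ?thesis .
    qed
    also have "\<dots> \<le> (\<alpha> + 5/2) * r * (K * real n powr (-\<alpha>))"
      using K(2)[OF n] assms r by (intro mult_left_mono) auto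
    also have "\<dots> = (\<alpha> + 5/2) * K * real n powr (1/2 - \<alpha>)"
      using n powr_diff[of "real n" "1/2" \<alpha>] by (simp add: r_def powr_minus_divide powr_half_sqrt)
    finally have "g x \<le> g a + (\<alpha> + 5/2) * K * real n powr (1/2 - \<alpha>)"
      by simp
    moreover have "g a \<le> S\<^sup>2 * real n powr (1/2 - \<alpha>)"
    proof -
      have "\<bar>M a\<bar> \<le> S"
        unfolding M_def using S(2)[of a n] a by simp
      then have "(M a)\<^sup>2 \<le> S\<^sup>2"
        using abs_le_square_iff[of "M a" S] S(1) by simp
      then have "g a \<le> (a powr (\<alpha> + 1/2) * 1) * S\<^sup>2"
        unfolding g_def using a by (intro mult_mono) auto
      also have "a powr (\<alpha> + 1/2) = real n powr (- (\<alpha> + 1/2))"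
        unfolding powr_minus_divide by (simp add: a_def powr_divide)
      \<comment> \<open>As n \<ge> 1, the exponent may be raised by 1 to match that of the integral
        term.\<close>
      also have "\<dots> \<le> real n powr (1/2 - \<alpha>)"
        using n by (intro powr_mono) auto
      finally show ?thesis
        using S(1) by (simp add: mult.commute)
    qed
    ultimately have gx: "g x \<le> C0 * real n powr (1/2 - \<alpha>)"
      by (simp add: C0_def algebra_simps)
    \<comment> \<open>Since x \<ge> a = 1/n and \<alpha> + 1/2 \<ge> 0, the weight x^(\<alpha> +
      1/2) in \<open>g x\<close> is at least n^(-(\<alpha> + 1/2)); removing it turns n^(1/2 -
      \<alpha>) into n.\<close>
    have "exp (-x) * (M x)\<^sup>2 = (a powr (\<alpha> + 1/2) * (exp (-x) * (M x)\<^sup>2)) * real n powr (\<alpha> + 1/2)"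
      using a n by (simp add: a_def powr_divide)
    also have "\<dots> \<le> g x * real n powr (\<alpha> + 1/2)"
      unfolding g_def mult.assoc using a assms
      by (intro mult_right_mono powr_mono2) auto
    also have "\<dots> \<le> C0 * real n powr (1/2 - \<alpha>) * real n powr (\<alpha> + 1/2)"
      using gx by (intro mult_right_mono) auto
    also have "\<dots> = C0 * real n"
      using n by (simp add: mult.assoc flip: powr_add)
    finally have "(M x)\<^sup>2 \<le> C0 * real n * exp x"
      by (simp add: exp_minus field_simps)
    also have "\<dots> = (sqrt C0 * sqrt (real n) * exp (1/2 * x))\<^sup>2"
      using \<open>C0 \<ge> 0\<close> by (simp add: power_mult_distrib flip: exp_double)
    finally show ?thesis
      unfolding M_def using \<open>C0 \<ge> 0\<close> by (intro power2_le_imp_le[of "\<bar>lagm n \<alpha> x\<bar>"]) auto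
  qed
  show ?thesis
  proof (rule that[of "S + sqrt C0"])
    fix n :: nat and t :: real
    assume nt: "n \<ge> 1" "t \<ge> 0"
    show "\<bar>lagm n \<alpha> t\<bar> \<le> (S + sqrt C0) * sqrt (real n) * exp (1/2 * t)"
    proof (cases "real n * t \<ge> 1")
      case True
      have "sqrt C0 * sqrt (real n) * exp (1/2 * t) \<le> (S + sqrt C0) * sqrt (real n) * exp (1/2 * t)"
        using S(1) by (intro mult_right_mono) auto
      then show ?thesis
        using far[OF nt(1) True] by linarith
    next
      case False
      then have "\<bar>lagm n \<alpha> t\<bar> \<le> S * 1 * 1"
        using S(2)[of t n] nt by simp
      also have "\<dots> \<le> (S + sqrt C0) * sqrt (real n) * exp (1/2 * t)"
        using nt S(1) \<open>C0 \<ge> 0\<close> by (intro mult_mono) auto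
      finally show ?thesis .
    qed
  qed (use S(1) \<open>C0 \<ge> 0\<close> in auto)
qed

section \<open>Bounds for the L^p norm\<close>

text \<open>With B = C n^(1/2) from \<open>lagm_sqrt_bound\<close>, \<open>abs_ell_powr_le\<close>
  gives a majorant that depends on n only through B^p = C^p n^(p/2).\<close>

lemma integral_ell_powr_bound_ge:
  assumes "p \<ge> 1" "\<alpha> > - 1 / p" "\<alpha> \<ge> -1/2"
  obtains A where "A \<ge> 0"
    "\<And>n. n \<ge> 1 \<Longrightarrow> (LINT t:{0..}|lborel. \<bar>ell n \<alpha> t\<bar> powr p) \<le> A * real n powr (p / 2)"
proof -
  have "\<alpha> > -1" "\<alpha> * p > -1"
    using assms by (auto simp: field_simps)
  obtain C where C: "C \<ge> 0"
    "\<And>n t. n \<ge> 1 \<Longrightarrow> t \<ge> 0 \<Longrightarrow> \<bar>lagm n \<alpha> t\<bar> \<le> C * sqrt (real n) * exp (1/2 * t)"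
    using lagm_sqrt_bound[OF assms(3)] by blast
  define D where "D = (LINT t:{0..}|lborel. t powr (\<alpha> * p) * exp (- (1/2 * t)))"
  have "D \<ge> 0"
    unfolding D_def set_lebesgue_integral_def by (intro Bochner_Integration.integral_nonneg) auto
  have "(LINT t:{0..}|lborel. \<bar>ell n \<alpha> t\<bar> powr p) \<le> (C powr p * D) * real n powr (p / 2)"
    if n: "n \<ge> 1" for n
  proof -
    have "(LINT t:{0..}|lborel. \<bar>ell n \<alpha> t\<bar> powr p) \<le>
        (LINT t:{0..}|lborel. (C * sqrt (real n)) powr p * (t powr (\<alpha> * p) * exp (- (1/2 * t))))"
      using assms \<open>\<alpha> > -1\<close> \<open>\<alpha> * p > -1\<close> C n
      by (intro set_integral_mono set_integrable_abs_ell_powr set_integrable_mult_right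
          set_integrable_powr_exp abs_ell_powr_le) auto
    also have "\<dots> = (C * sqrt (real n)) powr p * D"
      by (simp add: D_def)
    also have "(C * sqrt (real n)) powr p = C powr p * real n powr (p / 2)"
      using C n by (simp add: powr_mult powr_powr flip: powr_half_sqrt)
    finally show ?thesis
      by (simp add: mult_ac)
  qed
  then show ?thesis
    using that[of "C powr p * D"] \<open>D \<ge> 0\<close> by simp
qed

text \<open>Beyond \<open>1/n\<close>, where \<open>M\<close> exceeds \<open>h = n^(1/2) e^(t/2)\<close> one has \<open>M^p \<le> M^2 h^(p-2)\<close> since \<open>p \<le> 2\<close>,
  and the square integral applies; elsewhere \<open>M\<close> is bounded by \<open>h\<close> or by a constant.\<close>
lemma integral_ell_powr_bound_le:
  assumes "p \<ge> 1" "p \<le> 2" "\<alpha> > - 1 / p" "\<alpha> \<le> 0"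
  obtains A where "A \<ge> 0"
    "\<And>n. n \<ge> 1 \<Longrightarrow> (LINT t:{0..}|lborel. \<bar>ell n \<alpha> t\<bar> powr p) \<le> A * real n powr (p / 2)"
proof -
  have \<alpha>: "\<alpha> > -1" "\<alpha> * p > -1"
    using assms by (auto simp: field_simps) (smt (verit) mult_less_cancel_left1)
  obtain K where K: "K > 0" "\<And>n. n \<ge> 1 \<Longrightarrow> fact n / Gamma (real n + \<alpha> + 1) \<le> K * real n powr (-\<alpha>)"
    using Gamma_quotient_bound[OF \<open>\<alpha> > -1\<close>] by blast
  obtain S where S: "S > 0" "\<And>n t. t \<ge> 0 \<Longrightarrow> real n * t \<le> 1 \<Longrightarrow> \<bar>lagm n \<alpha> t\<bar> \<le> S"
    using lagm_bound_near_0[OF \<open>\<alpha> > -1\<close>] by blast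
  define D where "D = (LINT t:{0..}|lborel. t powr (\<alpha> * p) * exp (- (1/2 * t)))"
  have "D \<ge> 0"
    unfolding D_def set_lebesgue_integral_def by (intro Bochner_Integration.integral_nonneg) auto
  have "(LINT t:{0..}|lborel. \<bar>ell n \<alpha> t\<bar> powr p) \<le> ((S powr p + 1) * D + K) * real n powr (p / 2)"
    if n: "n \<ge> 1" for n
  proof -
    \<comment> \<open>\<open>c\<close> collects two estimates of powers with nonpositive exponent:
      |M|^(p - 2) \<le> n^(p/2 - 1) for |M| \<ge> n^(1/2), and t^(\<alpha> (p - 1)) \<le>
      n^(-\<alpha> (p - 1)) for t > 1/n.\<close>
    define c where "c = real n powr (p / 2 - 1 - \<alpha> * (p - 1))"
    \<comment> \<open>\<open>f1\<close> majorizes the integrand where |M| is at most S e^(t/2) or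
      n^(1/2) e^(t/2); the factor S^p + 1 serves both cases.\<close>
    define f1 where "f1 t = ((S powr p + 1) * real n powr (p / 2)) * (t powr (\<alpha> * p) * exp (- (1/2 * t)))" for t
    define f2 where "f2 t = c * (t powr \<alpha> * exp (-t) * (lagm n \<alpha> t)\<^sup>2)" for t
    have nonneg: "f1 t \<ge> 0" "f2 t \<ge> 0" for t
      by (auto simp: f1_def f2_def c_def)
    have f1I: "B powr p * (t powr (\<alpha> * p) * exp (- (1/2 * t))) \<le> f1 t"
      if "B powr p \<le> (S powr p + 1) * real n powr (p / 2)" for B t
      unfolding f1_def using that by (intro mult_right_mono) auto
    have "1 \<le> real n powr (p / 2)"
      using n assms by (intro ge_one_powr_ge_zero) auto
    have int: "set_integrable lborel {0..} f1" "set_integrable lborel {0..} f2"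
      unfolding f1_def f2_def using \<alpha>
      by (auto intro!: set_integrable_mult_right set_integrable_powr_exp set_integrable_lagm_squared
          simp del: times_divide_eq_left)
    have "(LINT t:{0..}|lborel. \<bar>ell n \<alpha> t\<bar> powr p) \<le> (LINT t:{0..}|lborel. f1 t + f2 t)"
    proof (rule set_integral_mono)
      show "set_integrable lborel {0..} (\<lambda>t. \<bar>ell n \<alpha> t\<bar> powr p)"
        using assms by (intro set_integrable_abs_ell_powr)
      show "set_integrable lborel {0..} (\<lambda>t. f1 t + f2 t)"
        using int by (rule set_integral_add)
    next
      fix t :: real
      assume "t \<in> {0..}"
      then have t: "t \<ge> 0" by simp
      consider (near) "real n * t \<le> 1" | (small) "\<bar>lagm n \<alpha> t\<bar> \<le> sqrt (real n) * exp (1/2 * t)"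
        | (large) "real n * t > 1" "\<bar>lagm n \<alpha> t\<bar> > sqrt (real n) * exp (1/2 * t)"
        by linarith
      then show "\<bar>ell n \<alpha> t\<bar> powr p \<le> f1 t + f2 t"
      proof cases
        case near
        have "S * 1 \<le> S * exp (1/2 * t)"
          using S(1) t by (intro mult_left_mono) auto
        then have "\<bar>lagm n \<alpha> t\<bar> \<le> S * exp (1/2 * t)"
          using S(2)[OF t near] by linarith
        then have "\<bar>ell n \<alpha> t\<bar> powr p \<le> S powr p * (t powr (\<alpha> * p) * exp (- (1/2 * t)))"
          using \<alpha> assms t S(1) by (intro abs_ell_powr_le) auto
        also have "S powr p * 1 \<le> (S powr p + 1) * real n powr (p / 2)"
          using \<open>1 \<le> real n powr (p / 2)\<close> by (intro mult_mono) auto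
        then have "S powr p * (t powr (\<alpha> * p) * exp (- (1/2 * t))) \<le> f1 t"
          by (intro f1I) simp
        finally show ?thesis
          using nonneg(2)[of t] by linarith
      next
        case small
        then have "\<bar>ell n \<alpha> t\<bar> powr p \<le> sqrt (real n) powr p * (t powr (\<alpha> * p) * exp (- (1/2 * t)))"
          using \<alpha> assms t by (intro abs_ell_powr_le) auto
        also have "sqrt (real n) powr p = 1 * real n powr (p / 2)"
          using n by (simp add: powr_powr flip: powr_half_sqrt)
        then have "sqrt (real n) powr p \<le> (S powr p + 1) * real n powr (p / 2)"
          by (simp add: algebra_simps)
        then have "sqrt (real n) powr p * (t powr (\<alpha> * p) * exp (- (1/2 * t))) \<le> f1 t"
          by (rule f1I)
        finally show ?thesis
          using nonneg(2)[of t] by linarith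
      next
        case large
        define m where "m = \<bar>lagm n \<alpha> t\<bar>"
        have "t > 0"
          using large(1) t by (cases "t = 0") auto
        have "sqrt (real n) * 1 \<le> sqrt (real n) * exp (1/2 * t)"
          using t by (intro mult_left_mono) auto
        then have m: "m > 0" "m \<ge> sqrt (real n)"
          using large(2) n real_sqrt_gt_zero[of "real n"] unfolding m_def by linarith+
        have "m powr p = m powr (p - 2) * m\<^sup>2"
          using m by (simp add: powr_diff powr_realpow)
        also have "m powr (p - 2) \<le> sqrt (real n) powr (p - 2)"
          using m assms n by (intro powr_mono2') auto
        also have "\<dots> = real n powr (p / 2 - 1)"
          using n by (simp add: powr_powr diff_divide_distrib flip: powr_half_sqrt)
        finally have mp: "m powr p \<le> real n powr (p / 2 - 1) * m\<^sup>2"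
          using m by simp
        have "t powr (\<alpha> * p) = t powr \<alpha> * t powr (\<alpha> * (p - 1))"
          by (simp add: algebra_simps flip: powr_add)
        also have "t powr (\<alpha> * (p - 1)) \<le> (1 / real n) powr (\<alpha> * (p - 1))"
          using \<open>t > 0\<close> large(1) n assms
          by (intro powr_mono2' mult_nonpos_nonneg) (auto simp: field_simps)
        also have "\<dots> = real n powr (- (\<alpha> * (p - 1)))"
          using n by (simp add: powr_divide powr_minus_divide)
        finally have tp: "t powr (\<alpha> * p) \<le> t powr \<alpha> * real n powr (- (\<alpha> * (p - 1)))"
          by (simp add: mult_left_mono)
        have ep: "exp (-t * p) \<le> exp (-t)"
          using t assms mult_left_mono[of 1 p t] by simp
        have "\<bar>ell n \<alpha> t\<bar> powr p = t powr (\<alpha> * p) * exp (-t * p) * m powr p"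
          using \<alpha> t by (simp add: ell_conv_lagm abs_mult m_def powr_mult powr_powr exp_powr_real)
        also have "\<dots> \<le> (t powr \<alpha> * real n powr (- (\<alpha> * (p - 1)))) * exp (-t) * (real n powr (p / 2 - 1) * m\<^sup>2)"
          using tp ep mp by (intro mult_mono) auto
        also have "\<dots> = (real n powr (p / 2 - 1) * real n powr (- (\<alpha> * (p - 1)))) * (t powr \<alpha> * exp (-t) * m\<^sup>2)"
          by simp
        also have "\<dots> = f2 t"
          by (simp add: f2_def c_def m_def flip: powr_add)
        finally show ?thesis
          using nonneg(1)[of t] by linarith
      qed
    qed
    also have "\<dots> = (LINT t:{0..}|lborel. f1 t) + (LINT t:{0..}|lborel. f2 t)"
      using int by (rule set_integral_add)
    also have "(LINT t:{0..}|lborel. f1 t) = (S powr p + 1) * D * real n powr (p / 2)"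
      unfolding f1_def set_integral_mult_right D_def by simp
    also have "(LINT t:{0..}|lborel. f2 t) = c * (fact n / Gamma (real n + \<alpha> + 1))"
      unfolding f2_def set_integral_mult_right set_integral_lagm_squared[OF \<alpha>(1)] ..
    also have "\<dots> \<le> c * (K * real n powr (-\<alpha>))"
      using K(2)[OF n] by (intro mult_left_mono) (auto simp: c_def)
    also have "\<dots> = K * real n powr (p / 2 - 1 - \<alpha> * p)"
      by (simp add: c_def algebra_simps flip: powr_add)
    \<comment> \<open>The exponent p/2 - 1 - \<alpha> p is below p/2 because \<alpha> p >
      -1.\<close>
    also have "\<dots> \<le> K * real n powr (p / 2)"
      using K(1) n \<alpha> by (intro mult_left_mono powr_mono) auto
    finally show ?thesis
      by (simp add: algebra_simps)
  qed
  then show ?thesis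
    using that[of "(S powr p + 1) * D + K"] \<open>D \<ge> 0\<close> K(1) by simp
qed

text \<open>The two integral bounds cover all parameters, since \<alpha> < -1/2 together with
  \<alpha> > -1/p forces p < 2.\<close>

lemma Lp_norm_ell_bound:
  assumes "p \<ge> 1" "\<alpha> > - 1 / p"
  shows "\<exists>C>0. \<forall>n\<ge>1. Lp_norm p (ell n \<alpha>) \<le> C * real n powr (1/2)"
proof -
  have "p \<le> 2" if "\<alpha> < -1/2"
  proof -
    have "-1 / p < -1/2"
      using that assms by linarith
    then show ?thesis
      using assms(1) by (simp add: field_simps)
  qed
  then consider "\<alpha> \<ge> -1/2" | "p \<le> 2" "\<alpha> \<le> 0"
    by linarith
  then obtain A where A: "A \<ge> 0"
    "\<And>n. n \<ge> 1 \<Longrightarrow> (LINT t:{0..}|lborel. \<bar>ell n \<alpha> t\<bar> powr p) \<le> A * real n powr (p / 2)"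
  proof cases
    case 1
    then show ?thesis
      using integral_ell_powr_bound_ge[OF assms] that by blast
  next
    case 2
    then show ?thesis
      using integral_ell_powr_bound_le[OF assms(1) _ assms(2)] that by blast
  qed
  \<comment> \<open>\<open>A + 1\<close> replaces \<open>A\<close>, which may be 0, to keep the
    constant positive.\<close>
  have "Lp_norm p (ell n \<alpha>) \<le> (A + 1) powr (1 / p) * real n powr (1/2)" if "n \<ge> 1" for n
  proof -
    have "(LINT t:{0..}|lborel. \<bar>ell n \<alpha> t\<bar> powr p) \<le> (A + 1) * real n powr (p / 2)"
      by (rule order.trans[OF A(2)[OF that]]) (intro mult_right_mono, auto)
    moreover have "(LINT t:{0..}|lborel. \<bar>ell n \<alpha> t\<bar> powr p) \<ge> 0"
      unfolding set_lebesgue_integral_def by (intro Bochner_Integration.integral_nonneg) auto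
    ultimately have "Lp_norm p (ell n \<alpha>) \<le> ((A + 1) * real n powr (p / 2)) powr (1 / p)"
      unfolding Lp_norm_def using assms by (intro powr_mono2) auto
    also have "\<dots> = (A + 1) powr (1 / p) * real n powr (1/2)"
      using assms A(1) by (simp add: powr_mult powr_powr)
    finally show ?thesis .
  qed
  moreover have "(A + 1) powr (1 / p) > 0"
    using A(1) by simp
  ultimately show ?thesis by blast
qed

section \<open>From integral bounds to the norm statements\<close>

lemma Lp_norm_1: "Lp_norm 1 f = (LINT t:{0..}|lborel. \<bar>f t\<bar>)"
proof -
  have "(LINT t:{0..}|lborel. \<bar>f t\<bar>) \<ge> 0"
    unfolding set_lebesgue_integral_def by (intro Bochner_Integration.integral_nonneg) auto
  then show ?thesis
    by (simp add: Lp_norm_def)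
qed

theorem theorem2p4:
  fixes \<alpha> :: real
  assumes "\<alpha> > -1"
  shows "(\<alpha> > 0 \<longrightarrow> (\<forall>n. Linf_norm (ell n \<alpha>) \<le> ereal (Lp_norm 1 (ell (n + 1) (\<alpha> - 1)))))
    \<and> (\<forall>n. in_Lp 1 (ell n \<alpha>))
    \<and> (\<exists>C>0. \<forall>n\<ge>1.
          (\<forall>t\<in>{t. laguerre n \<alpha> t = 0}. \<bar>ell (n - 1) \<alpha> t\<bar> \<le> Lp_norm 1 (ell n \<alpha>))
          \<and> Lp_norm 1 (ell n \<alpha>) \<le> C / real n powr (\<alpha> / 2))
    \<and> (\<forall>p::real. p \<ge> 1 \<and> \<alpha> > - 1 / p \<longrightarrow>
          (\<forall>n. in_Lp p (ell n \<alpha>))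
          \<and> (\<exists>C>0. \<forall>n\<ge>1. Lp_norm p (ell n \<alpha>) \<le> C * real n powr (1/2)))"
proof (intro conjI impI allI)
  fix n
  assume "\<alpha> > 0"
  then show "Linf_norm (ell n \<alpha>) \<le> ereal (Lp_norm 1 (ell (n + 1) (\<alpha> - 1)))"
    unfolding Linf_norm_def Lp_norm_1 using abs_ell_le_L1[of \<alpha> n]
    by (intro esssup_I) (auto intro!: measurable_restrict_space1)
next
  show "in_Lp 1 (ell n \<alpha>)" for n
    using assms by (intro in_Lp_ell) auto
next
  obtain C where C: "C > 0"
    "\<And>n. n \<ge> 1 \<Longrightarrow> (LINT t:{0..}|lborel. \<bar>ell n \<alpha> t\<bar>) \<le> C / real n powr (\<alpha> / 2)"
    using L1_ell_bound[OF assms] by blast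
  have "\<bar>ell (n - 1) \<alpha> t\<bar> \<le> Lp_norm 1 (ell n \<alpha>)" if "n \<ge> 1" "laguerre n \<alpha> t = 0" for n t
    unfolding Lp_norm_1 using abs_ell_le_L1_at_zero[OF assms, of "n - 1" t] that by simp
  with C show "\<exists>C>0. \<forall>n\<ge>1. (\<forall>t\<in>{t. laguerre n \<alpha> t = 0}. \<bar>ell (n - 1) \<alpha> t\<bar> \<le> Lp_norm 1 (ell n \<alpha>))
      \<and> Lp_norm 1 (ell n \<alpha>) \<le> C / real n powr (\<alpha> / 2)"
    by (auto simp: Lp_norm_1)
next
  fix p :: real
  assume "p \<ge> 1 \<and> \<alpha> > - 1 / p"
  then show "in_Lp p (ell n \<alpha>)" "\<exists>C>0. \<forall>n\<ge>1. Lp_norm p (ell n \<alpha>) \<le> C * real n powr (1/2)" for n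
    using in_Lp_ell Lp_norm_ell_bound by auto
qed

end
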